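(* Let $f \colon \mathbb{R} \to \mathbb{R}$ be a $1$-periodic continuous function, let $U$ be a random variable uniformly distributed on $[0,1]$, and let $(a_k)_{k\in\mathbb{N}}$ be a lacunary sequence with large gaps. Put $S_n := \sum_{k=1}^n f(a_k U)$ for $n\in\mathbb{N}$. Then the sequence $(S_n/n)_{n\in\mathbb{N}}$ satisfies a large deviation principle in $\mathbb{R}$ at speed $n$ and with good rate function $\widetilde{I}^f$, where $$\widetilde{I}^f(x) := \sup_{\theta\in\mathbb{R}}\bigl[\theta x - \widetilde{\Lambda}^f(\theta)\bigr],\qquad \widetilde{\Lambda}^f(\theta) := \log\int_0^1 \mathrm{e}^{\theta f(\omega)}\,\mathrm{d}\omega .$$
   Context: A sequence $(a_k)_{k\in\mathbb{N}}$ of positive integers is lacunary (a Hadamard gap sequence) if there is $q>1$ with $a_{k+1}/a_k \ge q$ for every $k\in\mathbb{N}$. It has large gaps if $a_{k+1}/a_k \to \infty$ as $k\to\infty$. A sequence $(X_n)_{n\in\mathbb{N}}$ of real random variables satisfies a large deviation principle (LDP) in $\mathbb{R}$ at speed $(s_n)_{n\in\mathbb{N}}$ (positive reals tending to infinity) with rate function $\mathbb{I}\colon\mathbb{R}\to[0,\infty]$ if $\mathbb{I}$ is lower semicontinuous and for every Borel set $A\subset\mathbb{R}$ $$-\inf_{x\in A^\circ}\mathbb{I}(x)\le\liminf_{n\to\infty}\frac1{s_n}\log\mathbb{P}[X_n\in A]\le\limsup_{n\to\infty}\frac1{s_n}\log\mathbb{P}[X_n\in A]\le-\inf_{x\in\overline{A}}\mathbb{I}(x),$$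 where $A^\circ$ and $\overline{A}$ are the interior and closure of $A$. "Speed $n$" means $s_n=n$. The rate function is called good if it has compact level sets $\{x : \mathbb{I}(x)\le c\}$, $c\in[0,\infty)$. *)

theory Defs
  imports "HOL-Probability.Probability"
begin

text \<open>Sequences indexed by the positive integers are functions on \<^typ>\<open>nat\<close> whose value at
  \<open>0\<close> is never used.\<close>

definition lacunary :: "(nat \<Rightarrow> nat) \<Rightarrow> bool" where
  "lacunary a \<longleftrightarrow> (\<forall>k\<ge>1. a k > 0) \<and>
     (\<exists>q::real. q > 1 \<and> (\<forall>k\<ge>1. real (a (Suc k)) / real (a k) \<ge> q))"

definition large_gaps :: "(nat \<Rightarrow> nat) \<Rightarrow> bool" where
  "large_gaps a \<longleftrightarrow> filterlim (\<lambda>k. real (a (Suc k)) / real (a k)) at_top sequentially"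

text \<open>Logarithm of a probability, with \<open>log 0 = -\<infinity>\<close> (the library has \<open>ln 0 = 0\<close>).\<close>

definition elog :: "real \<Rightarrow> ereal" where
  "elog p = (if p > 0 then ereal (ln p) else -\<infinity>)"

definition lower_semicontinuous :: "(real \<Rightarrow> ereal) \<Rightarrow> bool" where
  "lower_semicontinuous I \<longleftrightarrow> (\<forall>x. I x \<le> Liminf (at x) I)"

text \<open>In \<^typ>\<open>ereal\<close> the infimum over the empty set is \<open>\<infinity>\<close>, as the bounds below require.\<close>

definition LDP :: "'a measure \<Rightarrow> (nat \<Rightarrow> 'a \<Rightarrow> real) \<Rightarrow> (nat \<Rightarrow> real) \<Rightarrow> (real \<Rightarrow> ereal) \<Rightarrow> bool" where
  "LDP M X s I \<longleftrightarrow>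
     prob_space M \<and> (\<forall>n\<ge>1. X n \<in> borel_measurable M) \<and>
     (\<forall>n\<ge>1. s n > 0) \<and> filterlim s at_top sequentially \<and>
     (\<forall>x. I x \<ge> 0) \<and> lower_semicontinuous I \<and>
     (\<forall>A \<in> sets borel.
        - (INF x\<in>interior A. I x)
          \<le> liminf (\<lambda>n. ereal (1 / s n) * elog (measure M {\<omega> \<in> space M. X n \<omega> \<in> A})) \<and>
        liminf (\<lambda>n. ereal (1 / s n) * elog (measure M {\<omega> \<in> space M. X n \<omega> \<in> A}))
          \<le> limsup (\<lambda>n. ereal (1 / s n) * elog (measure M {\<omega> \<in> space M. X n \<omega> \<in> A})) \<and>
        limsup (\<lambda>n. ereal (1 / s n) * elog (measure M {\<omega> \<in> space M. X n \<omega> \<in> A}))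
          \<le> - (INF x\<in>closure A. I x))"

definition good_rate_function :: "(real \<Rightarrow> ereal) \<Rightarrow> bool" where
  "good_rate_function I \<longleftrightarrow> (\<forall>c::real. c \<ge> 0 \<longrightarrow> compact {x. I x \<le> ereal c})"

definition Lambda_tilde :: "(real \<Rightarrow> real) \<Rightarrow> real \<Rightarrow> real" where
  "Lambda_tilde f \<theta> = ln (LBINT \<omega>:{0..1}. exp (\<theta> * f \<omega>))"

definition I_tilde :: "(real \<Rightarrow> real) \<Rightarrow> real \<Rightarrow> ereal" where
  "I_tilde f x = (SUP \<theta>::real. ereal (\<theta> * x - Lambda_tilde f \<theta>))"

end

theory Submission
  imports Defs
begin

text \<open>Along a sequence with large gaps the functions \<open>f (a\<^sub>k U)\<close> are nearly independent copies of
\<open>f U\<close>: while \<open>u\<close> runs through a full period \<open>1 / a\<^sub>k\<close> of the \<open>k\<close>-th function, the later ones run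
through so many periods that they average out before the \<open>k\<close>-th one has changed. The proof turns
this into the statement that the normalised logarithmic moment generating functions
\<open>(1 / n) log E exp (\<theta> S\<^sub>n)\<close> converge to \<open>\<Lambda>(\<theta>) = log (\<integral> exp (\<theta> f))\<close>, the value they would have
for an i.i.d. sum (\<open>large_gaps_log_average\<close>), and then applies the Gaertner--Ellis argument.

For the convergence put \<open>g = exp (\<theta> f)\<close>, which is positive, continuous and periodic, and
consider the averages of \<open>\<Prod>j=k..n. g (a\<^sub>j u)\<close> over intervals of length \<open>1 / a\<^sub>k\<close>. Cut such
an interval into pieces of length \<open>1 / a\<^sub>k\<^sub>+\<^sub>1\<close>. On each piece the factor \<open>g (a\<^sub>k u)\<close> is constant up
to a multiplicative error, because \<open>a\<^sub>k / a\<^sub>k\<^sub>+\<^sub>1\<close> is small, and the remaining factors have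
the average to which the same bound applies at scale \<open>k + 1\<close>. So each scale contributes a factor
\<open>\<integral> g\<close> up to \<open>exp (\<plusminus>\<eta>)\<close>, and descending from \<open>n\<close> to a fixed \<open>K\<close> gives
\<open>(exp (\<plusminus>\<eta>) \<integral> g)\<^sup>n\<close> up to a constant (\<open>separated_scales_product_bounds\<close>). Since \<open>\<eta>\<close> is
arbitrary, the limit follows.

For the large deviations, the upper bound is Chernoff's inequality together with a finite covering
of a compact set by half lines: \<open>S\<^sub>n / n\<close> stays in a fixed compact interval because \<open>f\<close> is bounded.
For the lower bound at \<open>x = \<Lambda>'(\<theta>)\<close>, differentiability at \<open>\<theta>\<close> makes the part of
\<open>E exp (\<theta> S\<^sub>n)\<close> with \<open>S\<^sub>n / n\<close> away from \<open>x\<close> exponentially negligible, so the remaining part,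
at most \<open>exp (n \<theta> x)\<close> times the sought probability up to a small exponential error, has the size of
the whole (\<open>lower_bound_exposed\<close>). A point of finite rate need not be a derivative
of \<open>\<Lambda>\<close>; maximising \<open>\<theta> x - \<Lambda>(\<theta>) - \<epsilon> \<theta>\<^sup>2 / 2\<close> instead of \<open>\<theta> x - \<Lambda>(\<theta>)\<close> yields
derivatives that approximate it without increasing the rate (\<open>exposed_approximation\<close>).\<close>

section \<open>Continuous periodic functions\<close>

lemma periodic_integer_shift:
  fixes g :: "real \<Rightarrow> 'b"
  assumes "\<And>x. g (x + 1) = g x"
  shows "g (x + of_int i) = g x"
proof (induction i rule: int_induct[where k = 0])
  case base then show ?case by simp
next
  case (step1 i)
  have "g (x + of_int (i + 1)) = g ((x + of_int i) + 1)" by (simp add: add.assoc)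
  then show ?case using assms step1 by simp
next
  case (step2 i)
  have "g (x + of_int i) = g ((x + of_int (i - 1)) + 1)" by simp
  then show ?case using assms step2 by metis
qed

lemma periodic_eq_frac:
  fixes g :: "real \<Rightarrow> 'b"
  assumes "\<And>x. g (x + 1) = g x"
  shows "g x = g (frac x)"
  using periodic_integer_shift[of g "frac x" "\<lfloor>x\<rfloor>", OF assms] by (simp add: frac_def)

lemma integral_over_period:
  fixes g :: "real \<Rightarrow> real"
  assumes cont: "continuous_on UNIV g" and per: "\<And>x. g (x + 1) = g x"
  shows "integral {s..s + 1} g = integral {0..1} g"
proof -
  have int: "g integrable_on {u..v}" for u v
    by (intro integrable_continuous_real continuous_on_subset[OF cont]) auto
  define m where "m = real_of_int \<lfloor>s\<rfloor>"
  have m: "m \<le> s" "s \<le> m + 1" unfolding m_def by linarith+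
  have shift: "integral {u + c..v + c} g = integral {u..v} (\<lambda>x. g (x + c))" for u v c
    using integral_shift_Icc_real[of u v g c] by (simp add: o_def add.commute)
  have "integral {s..s+1} g = integral {s..m + 1} g + integral {m + 1..s + 1} g"
    using m by (intro Henstock_Kurzweil_Integration.integral_combine[symmetric] int) auto
  also have "integral {m + 1..s + 1} g = integral {m..s} g"
    using shift[of m 1 s] per by simp
  also have "integral {s..m + 1} g + integral {m..s} g = integral {m..m+1} g"
    using m by (subst add.commute, intro Henstock_Kurzweil_Integration.integral_combine int) auto
  also have "integral {m..m+1} g = integral {0..1} (\<lambda>x. g (x + m))"
    using shift[of 0 m 1] by (simp add: add.commute)
  also have "\<dots> = integral {0..1} g"
    using periodic_integer_shift[of g, OF per] unfolding m_def by simp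
  finally show ?thesis .
qed

lemma integral_over_scaled_period:
  fixes g :: "real \<Rightarrow> real"
  assumes cont: "continuous_on UNIV g" and per: "\<And>x. g (x + 1) = g x" and p: "p > 0"
  shows "integral {s..s + 1 / p} (\<lambda>u. g (p * u)) = integral {0..1} g / p"
proof -
  have *: "(\<lambda>x. x / p) ` {p * s..p * s + 1} = {s..s + 1 / p}"
    using p image_divide_atLeastAtMost[OF p, of "p * s" "p * s + 1"]
    by (simp add: field_simps)
  show ?thesis
    using integral_stretch_real[of p "p * s" "p * s + 1" g] p
      integral_over_period[of g "p * s", OF cont per]
    by (simp add: * field_simps)
qed

section \<open>Averaging over one scale\<close>

lemma integral_le_by_pieces:
  fixes F G :: "real \<Rightarrow> real"
  assumes F: "continuous_on UNIV F" and G: "continuous_on UNIV G" and h: "h \<ge> 0"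
    and piece: "\<And>r. integral {r..r + h} F \<le> integral {r..r + h} G"
  shows "integral {s..s + real m * h} F \<le> integral {s..s + real m * h} G"
proof (induction m)
  case 0 then show ?case by simp
next
  case (Suc m)
  have int: "F integrable_on {u..v}" "G integrable_on {u..v}" for u v
    by (intro integrable_continuous_real continuous_on_subset[OF F] continuous_on_subset[OF G]; simp)+
  have split: "integral {s..s + real (Suc m) * h} f = integral {s..s + real m * h} f
      + integral {s + real m * h..s + real m * h + h} f"
    if "f integrable_on {s..s + real (Suc m) * h}" for f :: "real \<Rightarrow> real"
    using Henstock_Kurzweil_Integration.integral_combine[of s "s + real m * h" "s + real (Suc m) * h" f] that h
    by (simp add: algebra_simps)
  show ?case
    unfolding split[OF int(1)] split[OF int(2)]
    using Suc piece[of "s + real m * h"] by (rule add_mono)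
qed

text \<open>If \<open>\<phi>\<close> oscillates on \<open>[r, r + h]\<close> by at most the factor \<open>R\<close>, it can be replaced by its value
\<open>\<phi> v\<close> at any point \<open>v\<close>; averaging over \<open>v\<close> then decouples \<open>\<phi>\<close> from \<open>H\<close>. The bound is
stated as an integral over the same interval so that it can be summed over adjacent intervals.\<close>

lemma integral_mult_le_if_small_oscillation:
  fixes \<phi> H :: "real \<Rightarrow> real"
  assumes \<phi>: "continuous_on UNIV \<phi>" and H: "continuous_on UNIV H" and Hpos: "\<And>u. H u \<ge> 0"
    and h: "h > 0" and osc: "\<And>u v. u \<in> {r..r+h} \<Longrightarrow> v \<in> {r..r+h} \<Longrightarrow> \<phi> u \<le> R * \<phi> v"
    and \<phi>pos: "\<And>u. \<phi> u \<ge> 0" and R: "R \<ge> 0"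
    and U: "integral {r..r+h} H \<le> U * h"
  shows "integral {r..r+h} (\<lambda>u. \<phi> u * H u) \<le> integral {r..r+h} (\<lambda>u. R * U * \<phi> u)"
proof -
  define J where "J = integral {r..r+h} (\<lambda>u. \<phi> u * H u)"
  have int: "F integrable_on {r..r+h}" if "continuous_on UNIV F" for F :: "real \<Rightarrow> real"
    by (intro integrable_continuous_real continuous_on_subset[OF that]) auto
  have pt: "J \<le> R * \<phi> v * (U * h)" if v: "v \<in> {r..r+h}" for v
  proof -
    have "J \<le> integral {r..r+h} (\<lambda>u. R * \<phi> v * H u)"
      unfolding J_def using osc v Hpos
      by (intro integral_le int continuous_intros \<phi> H) (auto intro!: mult_right_mono)
    also have "\<dots> = R * \<phi> v * integral {r..r+h} H" by simp
    also have "\<dots> \<le> R * \<phi> v * (U * h)"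
      using R \<phi>pos U by (intro mult_left_mono) auto
    finally show ?thesis .
  qed
  have "h * J = integral {r..r+h} (\<lambda>v. J)" using h by simp
  also have "\<dots> \<le> integral {r..r+h} (\<lambda>v. R * \<phi> v * (U * h))"
    using pt by (intro integral_le int continuous_intros \<phi>) auto
  also have "\<dots> = h * integral {r..r+h} (\<lambda>u. R * U * \<phi> u)"
    by (subst Henstock_Kurzweil_Integration.integral_mult_right[symmetric]) (simp add: mult_ac)
  finally show ?thesis using h unfolding J_def by simp
qed

text \<open>The mirror image, with a factor \<open>R\<close> below 1 in the intended use.\<close>

lemma integral_mult_ge_if_small_oscillation:
  fixes \<phi> H :: "real \<Rightarrow> real"
  assumes \<phi>: "continuous_on UNIV \<phi>" and H: "continuous_on UNIV H" and Hpos: "\<And>u. H u \<ge> 0"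
    and h: "h > 0" and osc: "\<And>u v. u \<in> {r..r+h} \<Longrightarrow> v \<in> {r..r+h} \<Longrightarrow> R * \<phi> v \<le> \<phi> u"
    and \<phi>pos: "\<And>u. \<phi> u \<ge> 0" and R: "R \<ge> 0"
    and L: "L * h \<le> integral {r..r+h} H"
  shows "integral {r..r+h} (\<lambda>u. R * L * \<phi> u) \<le> integral {r..r+h} (\<lambda>u. \<phi> u * H u)"
proof -
  define J where "J = integral {r..r+h} (\<lambda>u. \<phi> u * H u)"
  have int: "F integrable_on {r..r+h}" if "continuous_on UNIV F" for F :: "real \<Rightarrow> real"
    by (intro integrable_continuous_real continuous_on_subset[OF that]) auto
  have pt: "R * \<phi> v * (L * h) \<le> J" if v: "v \<in> {r..r+h}" for v
  proof -
    have "R * \<phi> v * (L * h) \<le> R * \<phi> v * integral {r..r+h} H"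
      using R \<phi>pos L by (intro mult_left_mono) auto
    also have "\<dots> = integral {r..r+h} (\<lambda>u. R * \<phi> v * H u)" by simp
    also have "\<dots> \<le> J"
      unfolding J_def using osc v Hpos
      by (intro integral_le int continuous_intros \<phi> H) (auto intro!: mult_right_mono)
    finally show ?thesis .
  qed
  have "h * integral {r..r+h} (\<lambda>u. R * L * \<phi> u) = integral {r..r+h} (\<lambda>v. R * \<phi> v * (L * h))"
    by (subst Henstock_Kurzweil_Integration.integral_mult_right[symmetric]) (simp add: mult_ac)
  also have "\<dots> \<le> integral {r..r+h} (\<lambda>v. J)"
    using pt by (intro integral_le int continuous_intros \<phi>) auto
  also have "\<dots> = h * J" using h by simp
  finally show ?thesis using h unfolding J_def by simp
qed

text \<open>The induction step from scale \<open>1 / q\<close> to the coarser scale \<open>1 / p\<close>. As \<open>q / p\<close> need not be an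
integer, a period \<open>1 / p\<close> is covered by slightly too many pieces of length \<open>1 / q\<close>; the excess is
shorter than one piece, where \<open>g\<close> is at most \<open>C\<close>, which accounts for the term \<open>C * (p / q)\<close>.\<close>

lemma scale_step_upper:
  fixes g H :: "real \<Rightarrow> real"
  assumes g: "continuous_on UNIV g" and per: "\<And>x. g (x + 1) = g x"
    and gpos: "\<And>x. g x \<ge> 0" and gC: "\<And>x. g x \<le> C"
    and H: "continuous_on UNIV H" and Hpos: "\<And>u. H u \<ge> 0"
    and p: "p > 0" and q: "q > 0"
    and osc: "\<And>x y. \<bar>x - y\<bar> \<le> p / q \<Longrightarrow> g x \<le> R * g y" and R: "R \<ge> 0"
    and U: "\<And>r. integral {r..r + 1 / q} H \<le> U / q" and U0: "U \<ge> 0"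
  shows "integral {s..s + 1 / p} (\<lambda>u. g (p * u) * H u)
    \<le> R * (integral {0..1} g + C * (p / q)) * U / p"
proof -
  define h where "h = 1 / q"
  define m where "m = nat \<lceil>q / p\<rceil>"
  let ?\<phi> = "\<lambda>u. g (p * u)"
  have \<phi>: "continuous_on UNIV ?\<phi>"
    by (intro continuous_on_compose2[OF g] continuous_intros) auto
  have h: "h > 0" using q by (simp add: h_def)
  have m: "q / p \<le> real m" "real m \<le> q / p + 1"
    unfolding m_def using p q by (simp_all add: of_nat_nat)
  have mh: "1 / p \<le> real m * h" "real m * h \<le> 1 / p + h"
    unfolding h_def using m p q by (simp_all add: field_simps)
  have int: "F integrable_on {u..v}" if "continuous_on UNIV F" for F :: "real \<Rightarrow> real" and u v
    by (intro integrable_continuous_real continuous_on_subset[OF that]) auto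
  have piece: "integral {r..r+h} (\<lambda>u. ?\<phi> u * H u) \<le> integral {r..r+h} (\<lambda>u. R * U * ?\<phi> u)" for r
  proof (rule integral_mult_le_if_small_oscillation[OF \<phi> H Hpos h _ gpos R])
    show "integral {r..r+h} H \<le> U * h" using U[of r] by (simp add: h_def)
    fix u v assume uv: "u \<in> {r..r+h}" "v \<in> {r..r+h}"
    have "\<bar>p * u - p * v\<bar> = p * \<bar>u - v\<bar>"
      using p by (simp add: abs_mult flip: right_diff_distrib)
    also have "\<dots> \<le> p * h" using uv p by (intro mult_left_mono) auto
    finally show "?\<phi> u \<le> R * ?\<phi> v" by (intro osc) (simp add: h_def)
  qed
  have "integral {s..s + 1 / p} (\<lambda>u. ?\<phi> u * H u) \<le> integral {s..s + real m * h} (\<lambda>u. ?\<phi> u * H u)"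
    using mh gpos Hpos by (intro integral_subset_le int continuous_intros \<phi> H) auto
  also have "\<dots> \<le> integral {s..s + real m * h} (\<lambda>u. R * U * ?\<phi> u)"
    using h by (intro integral_le_by_pieces piece continuous_intros \<phi> H) auto
  also have "\<dots> = R * U * integral {s..s + real m * h} ?\<phi>" by simp
  also have "\<dots> \<le> R * U * (integral {0..1} g / p + C * h)"
  proof (intro mult_left_mono)
    have "integral {s..s + real m * h} ?\<phi>
        = integral {s..s + 1 / p} ?\<phi> + integral {s + 1 / p..s + real m * h} ?\<phi>"
      using mh p by (intro Henstock_Kurzweil_Integration.integral_combine[symmetric] int \<phi>) auto
    also have "integral {s + 1 / p..s + real m * h} ?\<phi> \<le> integral {s + 1 / p..s + real m * h} (\<lambda>_. C)"
      using gC by (intro integral_le int \<phi>) auto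
    also have "\<dots> = C * (real m * h - 1 / p)" using mh by (simp add: mult.commute)
    also have "\<dots> \<le> C * h"
      using mh gC[of 0] gpos[of 0] by (intro mult_left_mono) auto
    finally show "integral {s..s + real m * h} ?\<phi> \<le> integral {0..1} g / p + C * h"
      using integral_over_scaled_period[of g p s, OF g per p] by simp
  qed (use R U0 in simp)
  also have "\<dots> = R * (integral {0..1} g + C * (p / q)) * U / p"
    using p by (simp add: h_def field_simps)
  finally show ?thesis .
qed

text \<open>The same with slightly too few pieces, whose union misses less than one piece of the period.\<close>

lemma scale_step_lower:
  fixes g H :: "real \<Rightarrow> real"
  assumes g: "continuous_on UNIV g" and per: "\<And>x. g (x + 1) = g x"
    and gpos: "\<And>x. g x \<ge> 0" and gC: "\<And>x. g x \<le> C"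
    and H: "continuous_on UNIV H" and Hpos: "\<And>u. H u \<ge> 0"
    and p: "p > 0" and q: "q > 0"
    and osc: "\<And>x y. \<bar>x - y\<bar> \<le> p / q \<Longrightarrow> R * g y \<le> g x" and R: "R \<ge> 0"
    and L: "\<And>r. L / q \<le> integral {r..r + 1 / q} H" and L0: "L \<ge> 0"
  shows "R * (integral {0..1} g - C * (p / q)) * L / p
    \<le> integral {s..s + 1 / p} (\<lambda>u. g (p * u) * H u)"
proof -
  define h where "h = 1 / q"
  define m where "m = nat \<lfloor>q / p\<rfloor>"
  let ?\<phi> = "\<lambda>u. g (p * u)"
  have \<phi>: "continuous_on UNIV ?\<phi>"
    by (intro continuous_on_compose2[OF g] continuous_intros) auto
  have h: "h > 0" using q by (simp add: h_def)
  have m: "real m \<le> q / p" "q / p \<le> real m + 1"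
    unfolding m_def using p q by (simp_all add: of_nat_nat)
  have mh: "real m * h \<le> 1 / p" "1 / p \<le> real m * h + h"
    unfolding h_def using m p q by (simp_all add: field_simps)
  have mh0: "real m * h \<ge> 0" using h by simp
  have int: "F integrable_on {u..v}" if "continuous_on UNIV F" for F :: "real \<Rightarrow> real" and u v
    by (intro integrable_continuous_real continuous_on_subset[OF that]) auto
  have piece: "integral {r..r+h} (\<lambda>u. R * L * ?\<phi> u) \<le> integral {r..r+h} (\<lambda>u. ?\<phi> u * H u)" for r
  proof (rule integral_mult_ge_if_small_oscillation[OF \<phi> H Hpos h _ gpos R])
    show "L * h \<le> integral {r..r+h} H" using L[of r] by (simp add: h_def)
    fix u v assume uv: "u \<in> {r..r+h}" "v \<in> {r..r+h}"
    have "\<bar>p * u - p * v\<bar> = p * \<bar>u - v\<bar>"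
      using p by (simp add: abs_mult flip: right_diff_distrib)
    also have "\<dots> \<le> p * h" using uv p by (intro mult_left_mono) auto
    finally show "R * ?\<phi> v \<le> ?\<phi> u" by (intro osc) (simp add: h_def)
  qed
  have "R * (integral {0..1} g - C * (p / q)) * L / p = R * L * (integral {0..1} g / p - C * h)"
    using p by (simp add: h_def field_simps)
  also have "\<dots> \<le> R * L * integral {s..s + real m * h} ?\<phi>"
  proof (intro mult_left_mono)
    have "integral {0..1} g / p = integral {s..s + 1 / p} ?\<phi>"
      using integral_over_scaled_period[of g p s, OF g per p] by simp
    also have "\<dots> = integral {s..s + real m * h} ?\<phi> + integral {s + real m * h..s + 1 / p} ?\<phi>"
      using mh mh0 p by (intro Henstock_Kurzweil_Integration.integral_combine[symmetric] int \<phi>) auto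
    also have "integral {s + real m * h..s + 1 / p} ?\<phi> \<le> integral {s + real m * h..s + 1 / p} (\<lambda>_. C)"
      using gC by (intro integral_le int \<phi>) auto
    also have "\<dots> = C * (1 / p - real m * h)" using mh by (simp add: mult.commute)
    also have "\<dots> \<le> C * h"
      using mh gC[of 0] gpos[of 0] by (intro mult_left_mono) auto
    finally show "integral {0..1} g / p - C * h \<le> integral {s..s + real m * h} ?\<phi>" by simp
  qed (use R L0 in simp)
  also have "\<dots> = integral {s..s + real m * h} (\<lambda>u. R * L * ?\<phi> u)" by simp
  also have "\<dots> \<le> integral {s..s + real m * h} (\<lambda>u. ?\<phi> u * H u)"
    using h by (intro integral_le_by_pieces piece continuous_intros \<phi> H) auto
  also have "\<dots> \<le> integral {s..s + 1 / p} (\<lambda>u. ?\<phi> u * H u)"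
    using mh gpos Hpos by (intro integral_subset_le int continuous_intros \<phi> H) auto
  finally show ?thesis .
qed

section \<open>The logarithmic average along a sequence with large gaps\<close>

lemma periodic_continuous_bounds:
  fixes f :: "real \<Rightarrow> real"
  assumes f: "continuous_on UNIV f" and per: "\<And>x. f (x + 1) = f x"
  obtains B where "B \<ge> 0" "\<And>x. \<bar>f x\<bar> \<le> B"
proof -
  have "bounded (f ` {0..1})"
    by (intro compact_imp_bounded compact_continuous_image continuous_on_subset[OF f]) auto
  then obtain B where B: "\<And>x. x \<in> {0..1} \<Longrightarrow> \<bar>f x\<bar> \<le> B"
    unfolding bounded_iff real_norm_def by blast
  have "\<bar>f x\<bar> \<le> B" for x
    using B[of "frac x"] periodic_eq_frac[of f, OF per, of x] frac_ge_0[of x] frac_lt_1[of x] by simp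
  moreover from B[of 0] have "B \<ge> 0" by simp
  ultimately show ?thesis using that by blast
qed

lemma periodic_continuous_uniformly:
  fixes f :: "real \<Rightarrow> real"
  assumes f: "continuous_on UNIV f" and per: "\<And>x. f (x + 1) = f x" and e: "e > 0"
  obtains d where "d > 0" "\<And>x y. \<bar>x - y\<bar> \<le> d \<Longrightarrow> \<bar>f x - f y\<bar> \<le> e"
proof -
  have "uniformly_continuous_on {-1..2} f"
    by (intro compact_uniformly_continuous continuous_on_subset[OF f]) auto
  then obtain d where d: "d > 0" "\<And>x y. x \<in> {-1..2} \<Longrightarrow> y \<in> {-1..2} \<Longrightarrow> dist y x < d \<Longrightarrow> dist (f y) (f x) < e"
    using e unfolding uniformly_continuous_on_def by meson
  show ?thesis
  proof (rule that[of "min (d/2) 1"])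
    show "min (d/2) 1 > 0" using d by simp
    fix x y :: real assume xy: "\<bar>x - y\<bar> \<le> min (d/2) 1"
    define i where "i = - \<lfloor>x\<rfloor>"
    have 1: "x + of_int i \<in> {0..1}" unfolding i_def by (simp; linarith)
    then have 2: "y + of_int i \<in> {-1..2}" using xy by auto
    have "dist (f (x + of_int i)) (f (y + of_int i)) < e"
      using 1 2 xy d(1) by (intro d(2)) (auto simp: dist_real_def)
    then show "\<bar>f x - f y\<bar> \<le> e"
      by (simp add: periodic_integer_shift[of f, OF per] dist_real_def)
  qed
qed

text \<open>Descending induction on \<open>k\<close>, starting from the empty product at \<open>k = n + 1\<close>. The statement is
uniform in the left end point \<open>s\<close> because the pieces of a period at scale \<open>k\<close> do not start at
multiples of the period at scale \<open>k + 1\<close>.\<close>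

lemma separated_scales_product_bounds:
  fixes g :: "real \<Rightarrow> real" and a :: "nat \<Rightarrow> nat"
  assumes g: "continuous_on UNIV g" and per: "\<And>x. g (x + 1) = g x"
    and gpos: "\<And>x. g x \<ge> 0" and gC: "\<And>x. g x \<le> C"
    and a: "\<And>k. k \<ge> K \<Longrightarrow> a k > 0"
    and ratio: "\<And>k. k \<ge> K \<Longrightarrow> real (a k) / real (a (Suc k)) \<le> \<rho>"
    and osc: "\<And>x y. \<bar>x - y\<bar> \<le> \<rho> \<Longrightarrow> g x \<le> R * g y" and R: "R > 0"
    and upper: "R * (integral {0..1} g + C * \<rho>) \<le> u"
    and lower: "l \<le> (integral {0..1} g - C * \<rho>) / R" and l: "l \<ge> 0"
    and k: "K \<le> k" "k \<le> Suc n"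
  shows "l ^ (Suc n - k) / a k \<le> integral {s..s + 1 / a k} (\<lambda>t::real. \<Prod>j=k..n. g (a j * t))
       \<and> integral {s..s + 1 / a k} (\<lambda>t::real. \<Prod>j=k..n. g (a j * t)) \<le> u ^ (Suc n - k) / a k"
  using k(2,1)
proof (induction arbitrary: s rule: inc_induct)
  case base
  then show ?case using a[of "Suc n"] by simp
next
  case (step k)
  let ?H = "\<lambda>t::real. \<Prod>j=Suc k..n. g (a j * t)"
  have C: "C \<ge> 0" using gpos[of 0] gC[of 0] by simp
  have ratio': "real (a k) / real (a (Suc k)) \<le> \<rho>" using ratio step by simp
  have ak: "real (a k) > 0" "real (a (Suc k)) > 0" using a step by simp_all
  have G: "integral {0..1} g \<ge> 0"
    by (intro integral_nonneg integrable_continuous_real continuous_on_subset[OF g]) (auto simp: gpos)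
  have \<rho>: "\<rho> \<ge> 0" using ratio' ak by (smt (verit) divide_nonneg_nonneg of_nat_0_le_iff)
  have u: "u \<ge> 0" using upper R G C \<rho> by (smt (verit) mult_nonneg_nonneg)
  have H: "continuous_on UNIV ?H"
    by (intro continuous_intros continuous_on_compose2[OF g]) auto
  have Hpos: "?H t \<ge> 0" for t by (intro prod_nonneg) (simp add: gpos)
  have exponent: "Suc n - k = Suc (Suc n - Suc k)" using step by simp
  have factor: "(\<lambda>t::real. \<Prod>j=k..n. g (a j * t)) = (\<lambda>t::real. g (a k * t) * ?H t)"
    using step by (subst prod.atLeast_Suc_atMost) auto
  have osc': "g x \<le> R * g y" if "\<bar>x - y\<bar> \<le> real (a k) / real (a (Suc k))" for x y
    using osc that ratio' by force
  have "integral {s..s + 1 / a k} (\<lambda>t::real. g (a k * t) * ?H t)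
    \<le> R * (integral {0..1} g + C * (real (a k) / real (a (Suc k)))) * u ^ (Suc n - Suc k) / a k"
    using step R u by (intro scale_step_upper[where g = g, OF g per gpos gC H Hpos ak osc']) auto
  also have "\<dots> \<le> u * u ^ (Suc n - Suc k) / a k"
  proof (intro divide_right_mono mult_right_mono)
    have "R * (integral {0..1} g + C * (real (a k) / real (a (Suc k)))) \<le> R * (integral {0..1} g + C * \<rho>)"
      using R C ratio' by (intro mult_left_mono add_left_mono) auto
    also note upper
    finally show "R * (integral {0..1} g + C * (real (a k) / real (a (Suc k)))) \<le> u" .
  qed (use u in auto)
  finally have up: "integral {s..s + 1 / a k} (\<lambda>t::real. g (a k * t) * ?H t) \<le> u ^ (Suc n - k) / a k"
    unfolding exponent by simp
  have "l ^ (Suc n - k) / a k = l * l ^ (Suc n - Suc k) / a k"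
    unfolding exponent by simp
  also have "\<dots> \<le> (1 / R) * (integral {0..1} g - C * (real (a k) / real (a (Suc k)))) * l ^ (Suc n - Suc k) / a k"
  proof (intro divide_right_mono mult_right_mono)
    note lower
    also have "(integral {0..1} g - C * \<rho>) / R
        \<le> (1 / R) * (integral {0..1} g - C * (real (a k) / real (a (Suc k))))"
      using R mult_left_mono[OF ratio' C] by (simp add: divide_right_mono)
    finally show "l \<le> (1 / R) * (integral {0..1} g - C * (real (a k) / real (a (Suc k))))" .
  qed (use l in auto)
  also have "\<dots> \<le> integral {s..s + 1 / a k} (\<lambda>t::real. g (a k * t) * ?H t)"
  proof (intro scale_step_lower[where g = g, OF g per gpos gC H Hpos ak])
    fix x y assume "\<bar>x - y\<bar> \<le> real (a k) / real (a (Suc k))"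
    then have "g y \<le> R * g x" by (intro osc') (simp add: abs_minus_commute)
    then show "1 / R * g y \<le> g x" using R by (simp add: field_simps)
  qed (use step l R in auto)
  finally show ?case using up unfolding factor by simp
qed

lemma unit_interval_pieces:
  fixes F :: "real \<Rightarrow> real" and m :: nat
  assumes F: "continuous_on UNIV F" and m: "m > 0"
    and piece: "\<And>r. l / m \<le> integral {r..r + 1 / m} F \<and> integral {r..r + 1 / m} F \<le> u / m"
  shows "l \<le> integral {0..1} F \<and> integral {0..1} F \<le> u"
proof -
  have "integral {0..0 + real m * (1 / m)} F \<le> integral {0..0 + real m * (1 / m)} (\<lambda>_. u)"
    using piece by (intro integral_le_by_pieces F continuous_intros) auto
  moreover have "integral {0..0 + real m * (1 / m)} (\<lambda>_. l) \<le> integral {0..0 + real m * (1 / m)} F"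
    using piece by (intro integral_le_by_pieces F continuous_intros) auto
  ultimately show ?thesis using m by simp
qed

lemma quotient_tendsto_if_linear_error:
  fixes x :: "nat \<Rightarrow> real"
  assumes bound: "\<And>\<eta>. \<eta> > 0 \<Longrightarrow> \<exists>A. \<forall>\<^sub>F n in sequentially. \<bar>x n - real n * l\<bar> \<le> A + real n * \<eta>"
  shows "(\<lambda>n. x n / real n) \<longlonglongrightarrow> l"
proof (rule tendstoI)
  fix e :: real assume e: "e > 0"
  obtain A where A: "\<forall>\<^sub>F n in sequentially. \<bar>x n - real n * l\<bar> \<le> A + real n * (e / 2)"
    using bound[of "e / 2"] e by auto
  obtain N where N: "2 * A / e < real N" using reals_Archimedean2 by blast
  show "\<forall>\<^sub>F n in sequentially. dist (x n / real n) l < e"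
    using A eventually_gt_at_top[of N]
  proof eventually_elim
    case (elim n)
    have n: "real n > 0" using elim by simp
    have "2 * A / e < real n" using N elim by linarith
    then have "A < real n * (e / 2)" using e by (simp add: field_simps)
    then have "\<bar>x n - real n * l\<bar> < real n * e" using elim by simp
    moreover have "x n / real n - l = (x n - real n * l) / real n" using n by (simp add: field_simps)
    ultimately show ?case using n by (simp add: dist_real_def field_simps)
  qed
qed

text \<open>The factors with index below a fixed \<open>K\<close>, for which the gaps may still be small, are bounded by
constants and disappear after division by \<open>n\<close>. For the others, \<open>[0, 1]\<close> splits into exactly
\<open>a K\<close> intervals of length \<open>1 / a K\<close>, on each of which \<open>separated_scales_product_bounds\<close> applies.\<close>

theorem large_gaps_log_average:
  fixes h :: "real \<Rightarrow> real" and a :: "nat \<Rightarrow> nat"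
  assumes h: "continuous_on UNIV h" and per: "\<And>x. h (x + 1) = h x"
    and a: "\<And>k. k \<ge> 1 \<Longrightarrow> a k > 0" and gaps: "large_gaps a"
  shows "(\<lambda>n. ln (integral {0..1} (\<lambda>t::real. exp (\<Sum>k=1..n. h (a k * t)))) / real n)
    \<longlonglongrightarrow> ln (integral {0..1} (\<lambda>t::real. exp (h t)))"
proof (rule quotient_tendsto_if_linear_error)
  fix \<eta> :: real assume \<eta>: "\<eta> > 0"
  define g where "g = (\<lambda>x. exp (h x))"
  define G where "G = integral {0..1} g"
  obtain B where B: "B \<ge> 0" "\<And>x. \<bar>h x\<bar> \<le> B"
    using periodic_continuous_bounds[of h, OF h per] by blast
  have g: "continuous_on UNIV g" unfolding g_def by (intro continuous_intros h)
  have gper: "g (x + 1) = g x" for x by (simp add: g_def per)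
  have gpos: "g x \<ge> 0" for x by (simp add: g_def)
  have g_upper: "g x \<le> exp B" for x using B(2)[of x] by (simp add: g_def)
  have g_lower: "exp (- B) \<le> g x" for x using B(2)[of x] by (simp add: g_def abs_le_iff)
  have int: "F integrable_on {u..v}" if "continuous_on UNIV F" for F :: "real \<Rightarrow> real" and u v
    by (intro integrable_continuous_real continuous_on_subset[OF that]) auto
  have "integral {0..1} (\<lambda>_::real. exp (- B)) \<le> G"
    unfolding G_def using g_lower by (intro integral_le int g) auto
  then have G: "G > 0" using less_le_trans[OF exp_gt_zero] by simp
  obtain d where d: "d > 0" "\<And>x y. \<bar>x - y\<bar> \<le> d \<Longrightarrow> \<bar>h x - h y\<bar> \<le> \<eta> / 2"
    using periodic_continuous_uniformly[of h "\<eta> / 2", OF h per] \<eta> by auto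
  \<comment> \<open>The error \<open>\<eta>\<close> is shared equally: a factor \<open>exp (\<plusminus>\<eta> / 2)\<close> for the oscillation of \<open>g\<close> at one scale,
    and another one for the incomplete piece, which is absorbed because \<open>exp B * \<rho>\<close> is small against \<open>G\<close>.\<close>
  define \<rho> where "\<rho> = min d (G * (1 - exp (- (\<eta> / 2))) / exp B)"
  have \<rho>: "\<rho> > 0" using d G \<eta> by (simp add: \<rho>_def)
  have \<rho>G: "exp B * \<rho> \<le> G * (1 - exp (- (\<eta> / 2)))"
    using min.cobounded2[of d "G * (1 - exp (- (\<eta> / 2))) / exp B"]
    unfolding \<rho>_def[symmetric] by (simp add: field_simps)
  have osc: "g x \<le> exp (\<eta> / 2) * g y" if "\<bar>x - y\<bar> \<le> \<rho>" for x y
  proof -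
    have "\<bar>h x - h y\<bar> \<le> \<eta> / 2" using that by (intro d(2)) (simp add: \<rho>_def)
    then have "h x \<le> \<eta> / 2 + h y" by linarith
    then show ?thesis by (simp add: g_def flip: exp_add)
  qed
  have lower: "exp (- \<eta>) * G \<le> (G - exp B * \<rho>) / exp (\<eta> / 2)"
  proof -
    have "exp (- \<eta>) * G * exp (\<eta> / 2) = G * exp (- (\<eta> / 2))"
      by (simp add: mult_ac flip: exp_add)
    also have "\<dots> \<le> G - exp B * \<rho>" using \<rho>G by (simp add: algebra_simps)
    finally show ?thesis by (simp add: pos_le_divide_eq)
  qed
  have upper: "exp (\<eta> / 2) * (G + exp B * \<rho>) \<le> exp \<eta> * G"
  proof -
    have "1 - exp (- (\<eta> / 2)) \<le> exp (\<eta> / 2) - 1"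
    proof -
      have "1 - exp (- (\<eta> / 2)) \<le> \<eta> / 2" using exp_ge_add_one_self[of "- (\<eta> / 2)"] by linarith
      then show ?thesis using exp_ge_add_one_self[of "\<eta> / 2"] by linarith
    qed
    then have "exp B * \<rho> \<le> G * (exp (\<eta> / 2) - 1)"
      using \<rho>G G by (meson less_eq_real_def mult_left_mono order_trans)
    then have "G + exp B * \<rho> \<le> exp (\<eta> / 2) * G" by (simp add: algebra_simps)
    then have "exp (\<eta> / 2) * (G + exp B * \<rho>) \<le> exp (\<eta> / 2) * (exp (\<eta> / 2) * G)" by simp
    also have "\<dots> = exp \<eta> * G" by (simp flip: exp_add mult.assoc)
    finally show ?thesis .
  qed
  have "\<forall>\<^sub>F k in sequentially. real (a (Suc k)) / real (a k) \<ge> 1 / \<rho>"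
    using gaps unfolding large_gaps_def filterlim_at_top by blast
  then obtain K where K: "K \<ge> 1" "\<And>k. k \<ge> K \<Longrightarrow> real (a (Suc k)) / real (a k) \<ge> 1 / \<rho>"
    unfolding eventually_sequentially by (metis le_trans linorder_linear)
  have ratio: "real (a k) / real (a (Suc k)) \<le> \<rho>" if "k \<ge> K" for k
    using K(2)[OF that] a[of k] a[of "Suc k"] K(1) that \<rho> by (simp add: field_simps)
  define F where "F = (\<lambda>n (t::real). \<Prod>j=K..n. g (a j * t))"
  have F: "continuous_on UNIV (F n)" for n
    unfolding F_def by (intro continuous_intros continuous_on_compose2[OF g]) auto
  have Fpos: "F n t \<ge> 0" for n t unfolding F_def by (intro prod_nonneg) (simp add: gpos)
  define A where "A = real K * (\<bar>ln G\<bar> + \<eta> + B)"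
  have "\<bar>ln (integral {0..1} (\<lambda>t::real. exp (\<Sum>k=1..n. h (a k * t)))) - real n * ln G\<bar> \<le> A + real n * \<eta>"
    if n: "n \<ge> K" for n
  proof -
    define m where "m = Suc n - K"
    define E where "E = integral {0..1} (\<lambda>t::real. exp (\<Sum>k=1..n. h (a k * t)))"
    have pieces: "(exp (- \<eta>) * G) ^ m \<le> integral {0..1} (F n) \<and> integral {0..1} (F n) \<le> (exp \<eta> * G) ^ m"
      unfolding m_def
    proof (rule unit_interval_pieces[OF F, of "a K"])
      fix r
      show "(exp (- \<eta>) * G) ^ (Suc n - K) / a K \<le> integral {r..r + 1 / a K} (F n)
          \<and> integral {r..r + 1 / a K} (F n) \<le> (exp \<eta> * G) ^ (Suc n - K) / a K"
        unfolding F_def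
      proof (rule separated_scales_product_bounds[where g = g and K = K and \<rho> = \<rho> and C = "exp B"])
        show "exp (\<eta> / 2) * (integral {0..1} g + exp B * \<rho>) \<le> exp \<eta> * G"
          using upper by (simp add: G_def)
        show "exp (- \<eta>) * G \<le> (integral {0..1} g - exp B * \<rho>) / exp (\<eta> / 2)"
          using lower by (simp add: G_def)
        show "0 < a k" if "k \<ge> K" for k using a K(1) that by simp
      qed (use g gper gpos g_upper ratio osc G n in auto)
    qed (use a K in auto)
    have head: "exp (- (real K * B)) * F n t \<le> exp (\<Sum>k=1..n. h (a k * t))
        \<and> exp (\<Sum>k=1..n. h (a k * t)) \<le> exp (real K * B) * F n t" for t :: real
    proof -
      define H where "H = (\<Sum>k=1..<K. h (a k * t))"
      have "{1..n} = {1..<K} \<union> {K..n}" using K n by auto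
      then have "(\<Sum>k=1..n. h (a k * t)) = H + (\<Sum>k=K..n. h (a k * t))"
        unfolding H_def by (simp only:) (subst sum.union_disjoint, auto)
      then have split: "exp (\<Sum>k=1..n. h (a k * t)) = exp H * F n t"
        by (simp add: exp_add exp_sum F_def g_def)
      have "\<bar>H\<bar> \<le> (\<Sum>k=1..<K. B)"
        unfolding H_def using B by (intro order_trans[OF sum_abs] sum_mono) auto
      also have "\<dots> \<le> real K * B" using B by (simp add: mult_right_mono)
      finally have "- (real K * B) \<le> H" "H \<le> real K * B" by (simp_all add: abs_le_iff)
      then show ?thesis unfolding split using Fpos by (auto intro!: mult_right_mono)
    qed
    have contE: "continuous_on UNIV (\<lambda>t::real. exp (\<Sum>k=1..n. h (a k * t)))"
      by (intro continuous_intros continuous_on_compose2[OF h]) auto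
    have "exp (- (real K * B)) * (exp (- \<eta>) * G) ^ m \<le> exp (- (real K * B)) * integral {0..1} (F n)"
      using pieces by simp
    also have "\<dots> = integral {0..1} (\<lambda>t::real. exp (- (real K * B)) * F n t)" by simp
    also have "\<dots> \<le> E" unfolding E_def
      using head by (intro integral_le int continuous_intros F contE) auto
    finally have E1: "exp (- (real K * B)) * (exp (- \<eta>) * G) ^ m \<le> E" .
    have "E \<le> integral {0..1} (\<lambda>t::real. exp (real K * B) * F n t)" unfolding E_def
      using head by (intro integral_le int continuous_intros F contE) auto
    also have "\<dots> = exp (real K * B) * integral {0..1} (F n)" by simp
    also have "\<dots> \<le> exp (real K * B) * (exp \<eta> * G) ^ m" using pieces by simp
    finally have E2: "E \<le> exp (real K * B) * (exp \<eta> * G) ^ m" .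
    have "0 < exp (- (real K * B)) * (exp (- \<eta>) * G) ^ m" using G by simp
    then have E0: "E > 0" using E1 by linarith
    have "ln (exp (- (real K * B)) * (exp (- \<eta>) * G) ^ m) \<le> ln E"
      using E1 G by (intro ln_mono) auto
    then have L1: "- (real K * B) + real m * (ln G - \<eta>) \<le> ln E"
      using G by (simp add: ln_mult ln_realpow)
    have "ln E \<le> ln (exp (real K * B) * (exp \<eta> * G) ^ m)"
      using E2 E0 by (intro ln_mono) auto
    then have L2: "ln E \<le> real K * B + real m * (ln G + \<eta>)"
      using G by (simp add: ln_mult ln_realpow add.commute)
    have m: "real m = real n - (real K - 1)" "real K - 1 \<ge> 0" "real K - 1 \<le> real K"
      unfolding m_def using n K by auto
    have "\<bar>(real K - 1) * ln G\<bar> \<le> real K * \<bar>ln G\<bar>"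
      using m by (simp add: abs_mult mult_right_mono)
    moreover have "0 \<le> (real K - 1) * \<eta>" "real m * \<eta> \<le> real n * \<eta>"
      using m \<eta> by (simp_all add: mult_right_mono)
    moreover have "real K * \<eta> \<ge> 0" using \<eta> by simp
    ultimately show ?thesis
      using L1 L2 unfolding E_def[symmetric] A_def m(1)
      by (simp add: algebra_simps abs_le_iff)
  qed
  then show "\<exists>A. \<forall>\<^sub>F n in sequentially.
      \<bar>ln (integral {0..1} (\<lambda>t::real. exp (\<Sum>k=1..n. h (a k * t)))) - real n * ln (integral {0..1} (\<lambda>t::real. exp (h t)))\<bar>
      \<le> A + real n * \<eta>"
    unfolding G_def g_def eventually_sequentially by blast
qed

section \<open>Large deviations from convergent logarithmic moment generating functions\<close>

lemma eventually_less_exp_mult: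
  assumes "c > 0"
  shows "\<forall>\<^sub>F n in sequentially. b < exp (real n * c)"
proof -
  obtain N where "b / c < real N" using reals_Archimedean2 by blast
  then have N: "b < real N * c" using assms by (simp add: field_simps)
  have "b < exp (real n * c)" if "n \<ge> N" for n
  proof -
    have "real N * c \<le> real n * c" using that assms by (intro mult_right_mono) auto
    then show ?thesis using N exp_ge_add_one_self[of "real n * c"] by linarith
  qed
  then show ?thesis unfolding eventually_sequentially by blast
qed

text \<open>The setting of the Gaertner--Ellis theorem for bounded averages \<open>Z n / n\<close>. The bound \<open>B\<close> makes all
moment generating functions finite and replaces the usual argument for exponential tightness.\<close>

locale bounded_log_mgf_limit = prob_space M for M :: "'a measure" +
  fixes Z :: "nat \<Rightarrow> 'a \<Rightarrow> real" and B :: real and \<Lambda> :: "real \<Rightarrow> real"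
  assumes rv [measurable]: "Z n \<in> borel_measurable M"
    and bounded: "\<omega> \<in> space M \<Longrightarrow> \<bar>Z n \<omega>\<bar> \<le> real n * B"
    and log_mgf_tendsto:
      "(\<lambda>n. ln (expectation (\<lambda>\<omega>. exp (\<theta> * Z n \<omega>))) / real n) \<longlonglongrightarrow> \<Lambda> \<theta>"
begin

definition mgf :: "nat \<Rightarrow> real \<Rightarrow> real" where
  "mgf n \<theta> = expectation (\<lambda>\<omega>. exp (\<theta> * Z n \<omega>))"

definition rate :: "real \<Rightarrow> ereal" where
  "rate x = (SUP \<theta>::real. ereal (\<theta> * x - \<Lambda> \<theta>))"

lemma integrable_exp: "integrable M (\<lambda>\<omega>. exp (\<theta> * Z n \<omega>))"
proof (rule integrable_const_bound)
  show "AE \<omega> in M. norm (exp (\<theta> * Z n \<omega>)) \<le> exp (\<bar>\<theta>\<bar> * (real n * B))"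
  proof (intro AE_I2)
    fix \<omega> assume "\<omega> \<in> space M"
    then have "\<theta> * Z n \<omega> \<le> \<bar>\<theta>\<bar> * (real n * B)"
      using bounded[of \<omega> n] by (metis abs_ge_self abs_ge_zero abs_mult mult_left_mono order_trans)
    then show "norm (exp (\<theta> * Z n \<omega>)) \<le> exp (\<bar>\<theta>\<bar> * (real n * B))" by simp
  qed
qed measurable

lemma mgf_pos: "mgf n \<theta> > 0"
proof -
  have "exp (- (\<bar>\<theta>\<bar> * (real n * B))) = expectation (\<lambda>_. exp (- (\<bar>\<theta>\<bar> * (real n * B))))"
    by (simp add: prob_space)
  also have "\<dots> \<le> mgf n \<theta>" unfolding mgf_def
  proof (intro integral_mono integrable_exp)
    fix \<omega> assume "\<omega> \<in> space M"
    then have "- (\<theta> * Z n \<omega>) \<le> \<bar>\<theta>\<bar> * (real n * B)"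
      using bounded[of \<omega> n] by (metis abs_ge_minus_self abs_ge_zero abs_mult mult_left_mono order_trans)
    then show "exp (- (\<bar>\<theta>\<bar> * (real n * B))) \<le> exp (\<theta> * Z n \<omega>)" by simp
  qed auto
  finally show ?thesis using less_le_trans[OF exp_gt_zero] by blast
qed

lemma eventually_mgf_less:
  assumes "\<Lambda> \<theta> < c"
  shows "\<forall>\<^sub>F n in sequentially. mgf n \<theta> < exp (real n * c)"
  using order_tendstoD(2)[OF log_mgf_tendsto assms] eventually_gt_at_top[of 0]
proof eventually_elim
  case (elim n)
  then have "ln (mgf n \<theta>) < real n * c" by (simp add: mgf_def field_simps)
  then have "exp (ln (mgf n \<theta>)) < exp (real n * c)" by simp
  then show ?case using mgf_pos by simp
qed

lemma eventually_mgf_greater: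
  assumes "c < \<Lambda> \<theta>"
  shows "\<forall>\<^sub>F n in sequentially. exp (real n * c) < mgf n \<theta>"
  using order_tendstoD(1)[OF log_mgf_tendsto assms] eventually_gt_at_top[of 0]
proof eventually_elim
  case (elim n)
  then have "real n * c < ln (mgf n \<theta>)" by (simp add: mgf_def field_simps)
  then have "exp (real n * c) < exp (ln (mgf n \<theta>))" by simp
  then show ?case using mgf_pos by simp
qed

lemma \<Lambda>_0: "\<Lambda> 0 = 0"
  using log_mgf_tendsto[of 0] by (simp add: prob_space LIMSEQ_const_iff)

lemma rate_upper: "ereal (\<theta> * x - \<Lambda> \<theta>) \<le> rate x"
  unfolding rate_def by (rule SUP_upper) simp

lemma rate_nonneg: "rate x \<ge> 0"
  using rate_upper[of 0 x] by (simp add: \<Lambda>_0 zero_ereal_def)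

lemma exp_times_prob_le:
  assumes E: "E \<in> events" and b: "\<And>\<omega>. \<omega> \<in> E \<Longrightarrow> b \<le> \<theta> * Z n \<omega>"
  shows "exp b * prob E \<le> mgf n \<theta>"
proof -
  have "exp b * prob E = expectation (\<lambda>\<omega>. exp b * indicator E \<omega>)" using E by simp
  also have "\<dots> \<le> mgf n \<theta>" unfolding mgf_def
    using E b by (intro integral_mono integrable_exp integrable_mult_right integrable_real_indicator)
      (auto simp: less_top[symmetric] split: split_indicator)
  finally show ?thesis .
qed

lemma eventually_prob_half_line:
  assumes "\<gamma> > 0"
  shows "\<forall>\<^sub>F n in sequentially.
    prob {\<omega> \<in> space M. \<theta> * (Z n \<omega> / real n) - \<Lambda> \<theta> > \<alpha>} \<le> exp (- real n * (\<alpha> - \<gamma>))"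
proof -
  have "\<forall>\<^sub>F n in sequentially. mgf n \<theta> < exp (real n * (\<Lambda> \<theta> + \<gamma>))"
    using assms by (intro eventually_mgf_less) simp
  then show ?thesis using eventually_gt_at_top[of 0]
  proof eventually_elim
    case (elim n)
    let ?E = "{\<omega> \<in> space M. \<theta> * (Z n \<omega> / real n) - \<Lambda> \<theta> > \<alpha>}"
    have "exp (real n * (\<alpha> + \<Lambda> \<theta>)) * prob ?E \<le> mgf n \<theta>"
      using elim(2) by (intro exp_times_prob_le) (auto simp: field_simps)
    also have "\<dots> \<le> exp (real n * (\<Lambda> \<theta> + \<gamma>))" using elim(1) assms by simp
    also have "\<dots> = exp (real n * (\<alpha> + \<Lambda> \<theta>)) * exp (- real n * (\<alpha> - \<gamma>))"
      by (simp add: algebra_simps flip: exp_add)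
    finally show ?case by simp
  qed
qed

text \<open>Every point of \<open>closure A\<close> lies in one of the open sets \<open>{y. \<theta> * y - \<Lambda> \<theta> > \<alpha>}\<close>, to which the exponential
Markov inequality applies. By compactness finitely many of them suffice, and their number is absorbed by
half of the slack \<open>\<gamma>\<close>.\<close>

lemma upper_bound:
  assumes A: "\<And>x. x \<in> closure A \<Longrightarrow> ereal \<alpha> < rate x" and \<gamma>: "\<gamma> > 0"
  shows "\<forall>\<^sub>F n in sequentially.
    prob {\<omega> \<in> space M. Z n \<omega> / real n \<in> A} \<le> exp (- real n * (\<alpha> - \<gamma>))"
proof -
  define V where "V = (\<lambda>\<theta>. {y. \<theta> * y - \<Lambda> \<theta> > \<alpha>})"
  have "open (V \<theta>)" for \<theta>
    unfolding V_def by (intro open_Collect_less continuous_intros)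
  moreover have "closure A \<inter> {-B..B} \<subseteq> (\<Union>\<theta>\<in>UNIV. V \<theta>)"
    using A by (auto simp: V_def rate_def less_SUP_iff)
  moreover have "compact (closure A \<inter> {-B..B})"
    by (intro closed_Int_compact) auto
  ultimately obtain T where T: "finite T" "closure A \<inter> {-B..B} \<subseteq> (\<Union>\<theta>\<in>T. V \<theta>)"
    by (metis compactE_image)
  have "\<forall>\<^sub>F n in sequentially. \<forall>\<theta>\<in>T. prob {\<omega> \<in> space M. \<theta> * (Z n \<omega> / real n) - \<Lambda> \<theta> > \<alpha>}
      \<le> exp (- real n * (\<alpha> - \<gamma> / 2))"
    using T(1) \<gamma> eventually_prob_half_line by (intro eventually_ball_finite) auto
  moreover have "\<forall>\<^sub>F n in sequentially. real (card T) \<le> exp (real n * (\<gamma> / 2))"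
  proof -
    show ?thesis using eventually_less_exp_mult[of "\<gamma> / 2" "real (card T)"] \<gamma>
      by (auto elim: eventually_mono)
  qed
  ultimately show ?thesis using eventually_gt_at_top[of 0]
  proof eventually_elim
    case (elim n)
    let ?E = "\<lambda>\<theta>. {\<omega> \<in> space M. \<theta> * (Z n \<omega> / real n) - \<Lambda> \<theta> > \<alpha>}"
    have "{\<omega> \<in> space M. Z n \<omega> / real n \<in> A} \<subseteq> (\<Union>\<theta>\<in>T. ?E \<theta>)"
    proof
      fix \<omega> assume \<omega>: "\<omega> \<in> {\<omega> \<in> space M. Z n \<omega> / real n \<in> A}"
      then have "\<bar>Z n \<omega> / real n\<bar> \<le> B"
        using bounded[of \<omega> n] elim(3) by (simp add: field_simps)
      then have "- B \<le> Z n \<omega> / real n" "Z n \<omega> / real n \<le> B" by linarith+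
      then have "Z n \<omega> / real n \<in> closure A \<inter> {-B..B}"
        using \<omega> closure_subset[of A] by auto
      then show "\<omega> \<in> (\<Union>\<theta>\<in>T. ?E \<theta>)" using T(2) \<omega> unfolding V_def by blast
    qed
    then have "prob {\<omega> \<in> space M. Z n \<omega> / real n \<in> A} \<le> prob (\<Union>\<theta>\<in>T. ?E \<theta>)"
      using T(1) by (intro finite_measure_mono) auto
    also have "\<dots> \<le> (\<Sum>\<theta>\<in>T. prob (?E \<theta>))"
      using T(1) by (intro finite_measure_subadditive_finite) auto
    also have "\<dots> \<le> (\<Sum>\<theta>\<in>T. exp (- real n * (\<alpha> - \<gamma> / 2)))"
      using elim(1) by (intro sum_mono) auto
    also have "\<dots> \<le> exp (real n * (\<gamma> / 2)) * exp (- real n * (\<alpha> - \<gamma> / 2))"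
      using elim(2) by (simp add: mult_right_mono)
    also have "\<dots> = exp (- real n * (\<alpha> - \<gamma>))" by (simp add: algebra_simps flip: exp_add)
    finally show ?case .
  qed
qed

text \<open>Instead of changing the measure to one with density proportional to \<open>exp (\<theta> * Z n)\<close>, the expectation of
this weight is split into the part near \<open>x\<close> and two tails. In the upper tail the weight is at most
\<open>exp ((\<theta> + t) * Z n - n * t * (x + \<delta>))\<close>, and \<open>\<Lambda> (\<theta> + t)\<close> is close to
\<open>\<Lambda> \<theta> + t * x\<close> since \<open>x\<close> is the derivative; hence the tail is exponentially smaller than
the whole expectation. The lower tail is treated by the same argument with \<open>-t\<close>.\<close>

lemma lower_bound_exposed:
  assumes D: "(\<Lambda> has_real_derivative x) (at \<theta>)" and W: "open W" "x \<in> W" and \<gamma>: "\<gamma> > 0"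
  shows "\<forall>\<^sub>F n in sequentially.
    exp (- real n * (\<theta> * x - \<Lambda> \<theta> + \<gamma>)) \<le> prob {\<omega> \<in> space M. Z n \<omega> / real n \<in> W}"
proof -
  obtain \<delta>0 where \<delta>0: "\<delta>0 > 0" "ball x \<delta>0 \<subseteq> W" using W open_contains_ball by blast
  define \<delta> where "\<delta> = min \<delta>0 (\<gamma> / (2 * (\<bar>\<theta>\<bar> + 1)))"
  have \<delta>: "\<delta> > 0" "\<delta> \<le> \<delta>0" using \<delta>0 \<gamma> by (auto simp: \<delta>_def)
  have \<theta>\<delta>: "\<bar>\<theta>\<bar> * \<delta> \<le> \<gamma> / 2"
  proof -
    have "(\<bar>\<theta>\<bar> + 1) * \<delta> \<le> (\<bar>\<theta>\<bar> + 1) * (\<gamma> / (2 * (\<bar>\<theta>\<bar> + 1)))"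
      unfolding \<delta>_def by (intro mult_left_mono) auto
    also have "\<dots> = \<gamma> / 2" by (simp add: field_simps)
    finally show ?thesis using \<delta>(1) by (simp add: algebra_simps)
  qed
  have "((\<lambda>h. (\<Lambda> (\<theta> + h) - \<Lambda> \<theta>) / h) \<longlongrightarrow> x) (at 0)" using D by (simp add: DERIV_def)
  then have "\<forall>\<^sub>F h in at 0. dist ((\<Lambda> (\<theta> + h) - \<Lambda> \<theta>) / h) x < \<delta> / 2"
    using \<delta>(1) by (intro tendstoD) auto
  then obtain t0 where t0: "t0 > 0"
    "\<And>h. h \<noteq> 0 \<Longrightarrow> \<bar>h\<bar> < t0 \<Longrightarrow> \<bar>(\<Lambda> (\<theta> + h) - \<Lambda> \<theta>) / h - x\<bar> < \<delta> / 2"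
    unfolding eventually_at dist_real_def by auto
  define t where "t = t0 / 2"
  have t: "t > 0" "t < t0" using t0 by (auto simp: t_def)
  have slope: "\<Lambda> (\<theta> + h) < \<Lambda> \<theta> + h * x + t * \<delta> / 2" if h: "\<bar>h\<bar> = t" for h
  proof -
    have "\<Lambda> (\<theta> + h) - \<Lambda> \<theta> - h * x = h * ((\<Lambda> (\<theta> + h) - \<Lambda> \<theta>) / h - x)"
      using h t by (auto simp: field_simps)
    also have "\<dots> \<le> \<bar>h\<bar> * \<bar>(\<Lambda> (\<theta> + h) - \<Lambda> \<theta>) / h - x\<bar>" by (metis abs_ge_self abs_mult)
    also have "\<dots> < t * (\<delta> / 2)"
      unfolding h using t h t0(2)[of h] by (intro mult_strict_left_mono) auto
    finally show ?thesis by simp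
  qed
  \<comment> \<open>Each tail is of order \<open>exp (n * (\<Lambda> \<theta> - t * \<delta> / 2))\<close>, so a loss of \<open>\<kappa>\<close> in the whole
    expectation must be at most half of \<open>t * \<delta> / 2\<close>, and two such losses at most half of \<open>\<gamma>\<close>.\<close>
  define \<kappa> where "\<kappa> = min (t * \<delta> / 4) (\<gamma> / 4)"
  have \<kappa>: "\<kappa> > 0" "\<kappa> \<le> t * \<delta> / 4" "\<kappa> \<le> \<gamma> / 4" using t \<delta> \<gamma> by (auto simp: \<kappa>_def)
  have ev1: "\<forall>\<^sub>F n in sequentially. mgf n (\<theta> + h) < exp (real n * (\<Lambda> \<theta> + h * x + t * \<delta> / 2))"
    if "\<bar>h\<bar> = t" for h by (rule eventually_mgf_less[OF slope[OF that]])
  have ev2: "\<forall>\<^sub>F n in sequentially. exp (real n * (\<Lambda> \<theta> - \<kappa>)) < mgf n \<theta>"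
    using \<kappa> by (intro eventually_mgf_greater) auto
  have ev3: "\<forall>\<^sub>F n in sequentially. 4 < exp (real n * \<kappa>)"
    by (rule eventually_less_exp_mult[OF \<kappa>(1)])
  have "\<bar>t\<bar> = t" "\<bar>-t\<bar> = t" using t by auto
  from ev1[OF this(1)] ev1[OF this(2)] ev2 ev3 eventually_gt_at_top[of 0] show ?thesis
  proof eventually_elim
    case (elim n)
    have n: "real n > 0" using elim by simp
    let ?E = "{\<omega> \<in> space M. Z n \<omega> / real n \<in> ball x \<delta>}"
    define c where "c = real n * (\<theta> * x + \<bar>\<theta>\<bar> * \<delta>)"
    have point: "exp (\<theta> * Z n \<omega>) \<le> exp c * indicator ?E \<omega>
        + exp (- real n * t * (x + \<delta>)) * exp ((\<theta> + t) * Z n \<omega>)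
        + exp (real n * t * (x - \<delta>)) * exp ((\<theta> - t) * Z n \<omega>)" (is "_ \<le> ?a + ?b + ?d")
      if \<omega>: "\<omega> \<in> space M" for \<omega>
    proof -
      define z where "z = Z n \<omega> / real n"
      have Z: "Z n \<omega> = real n * z" using n by (simp add: z_def)
      have nn: "?a \<ge> 0" "?b \<ge> 0" "?d \<ge> 0" by (auto simp: indicator_def)
      consider "\<bar>z - x\<bar> < \<delta>" | "z \<ge> x + \<delta>" | "z \<le> x - \<delta>" by linarith
      then show ?thesis
      proof cases
        case 1
        have "\<theta> * (z - x) \<le> \<bar>\<theta>\<bar> * \<bar>z - x\<bar>" by (metis abs_ge_self abs_mult)
        also have "\<dots> \<le> \<bar>\<theta>\<bar> * \<delta>" using 1 by (intro mult_left_mono) auto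
        finally have "\<theta> * (z - x) \<le> \<bar>\<theta>\<bar> * \<delta>" .
        then have "real n * (\<theta> * (z - x)) \<le> real n * (\<bar>\<theta>\<bar> * \<delta>)"
          using n by (intro mult_left_mono) auto
        then have "\<theta> * Z n \<omega> \<le> c"
          unfolding c_def Z by (simp add: algebra_simps)
        moreover have "\<omega> \<in> ?E" using 1 \<omega> by (simp add: z_def dist_real_def abs_minus_commute)
        ultimately have "exp (\<theta> * Z n \<omega>) \<le> ?a" by simp
        then show ?thesis using nn by linarith
      next
        case 2
        have "0 \<le> real n * t * (z - (x + \<delta>))" using 2 n t by simp
        then have "exp (\<theta> * Z n \<omega>) \<le> ?b" unfolding Z by (simp add: algebra_simps flip: exp_add)
        then show ?thesis using nn by linarith
      next
        case 3
        have "0 \<le> real n * t * ((x - \<delta>) - z)" using 3 n t by simp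
        then have "exp (\<theta> * Z n \<omega>) \<le> ?d" unfolding Z by (simp add: algebra_simps flip: exp_add)
        then show ?thesis using nn by linarith
      qed
    qed
    have [measurable]: "ball x \<delta> \<in> sets borel" by simp
    have [measurable]: "?E \<in> events" by measurable
    have "integrable M (indicat_real ?E)"
      by (intro integrable_real_indicator) (simp_all add: less_top[symmetric] del: mem_ball)
    then have int: "integrable M (\<lambda>\<omega>. exp c * indicator ?E \<omega>)"
      "integrable M (\<lambda>\<omega>. exp (- real n * t * (x + \<delta>)) * exp ((\<theta> + t) * Z n \<omega>))"
      "integrable M (\<lambda>\<omega>. exp (real n * t * (x - \<delta>)) * exp ((\<theta> - t) * Z n \<omega>))"
      by (intro integrable_mult_right integrable_exp; assumption)+
    have "mgf n \<theta> \<le> expectation (\<lambda>\<omega>. exp c * indicator ?E \<omega>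
        + exp (- real n * t * (x + \<delta>)) * exp ((\<theta> + t) * Z n \<omega>)
        + exp (real n * t * (x - \<delta>)) * exp ((\<theta> - t) * Z n \<omega>))"
      unfolding mgf_def
      by (intro integral_mono point integrable_exp Bochner_Integration.integrable_add int)
    also have "\<dots> = exp c * prob ?E + exp (- real n * t * (x + \<delta>)) * mgf n (\<theta> + t)
        + exp (real n * t * (x - \<delta>)) * mgf n (\<theta> - t)"
      unfolding mgf_def
      by (subst Bochner_Integration.integral_add, intro Bochner_Integration.integrable_add int, rule int,
          subst Bochner_Integration.integral_add, rule int, rule int) (simp del: mem_ball)
    also have "\<dots> \<le> exp c * prob ?E + exp (real n * (\<Lambda> \<theta> - t * \<delta> / 2)) + exp (real n * (\<Lambda> \<theta> - t * \<delta> / 2))"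
    proof (intro add_mono order_refl)
      have "exp (- real n * t * (x + \<delta>)) * mgf n (\<theta> + t)
          \<le> exp (- real n * t * (x + \<delta>)) * exp (real n * (\<Lambda> \<theta> + t * x + t * \<delta> / 2))"
        using elim(1) by (intro mult_left_mono) auto
      also have "\<dots> = exp (real n * (\<Lambda> \<theta> - t * \<delta> / 2))" by (simp add: field_simps flip: exp_add)
      finally show "exp (- real n * t * (x + \<delta>)) * mgf n (\<theta> + t) \<le> exp (real n * (\<Lambda> \<theta> - t * \<delta> / 2))" .
      have "exp (real n * t * (x - \<delta>)) * mgf n (\<theta> - t)
          \<le> exp (real n * t * (x - \<delta>)) * exp (real n * (\<Lambda> \<theta> - t * x + t * \<delta> / 2))"
        using elim(2) by (intro mult_left_mono) auto
      also have "\<dots> = exp (real n * (\<Lambda> \<theta> - t * \<delta> / 2))" by (simp add: field_simps flip: exp_add)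
      finally show "exp (real n * t * (x - \<delta>)) * mgf n (\<theta> - t) \<le> exp (real n * (\<Lambda> \<theta> - t * \<delta> / 2))" .
    qed
    finally have main: "exp (real n * (\<Lambda> \<theta> - \<kappa>)) \<le> exp c * prob ?E + 2 * exp (real n * (\<Lambda> \<theta> - t * \<delta> / 2))"
      using elim(3) by linarith
    have "4 * exp (real n * (\<Lambda> \<theta> - t * \<delta> / 2)) \<le> exp (real n * \<kappa>) * exp (real n * (\<Lambda> \<theta> - 2 * \<kappa>))"
      using elim(4) \<kappa> n by (intro mult_mono) auto
    also have "\<dots> = exp (real n * (\<Lambda> \<theta> - \<kappa>))" by (simp add: algebra_simps flip: exp_add)
    finally have "exp (real n * (\<Lambda> \<theta> - \<kappa>)) \<le> 2 * (exp c * prob ?E)" using main by linarith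
    also have "\<dots> \<le> exp (real n * \<kappa>) * (exp c * prob ?E)"
      using elim(4) by (intro mult_right_mono) auto
    finally have "exp (real n * (\<Lambda> \<theta> - \<kappa>)) \<le> exp (real n * \<kappa> + c) * prob ?E"
      by (simp add: exp_add mult.assoc)
    then have "exp (real n * (\<Lambda> \<theta> - \<kappa>) - (real n * \<kappa> + c)) \<le> prob ?E"
      by (simp only: exp_diff pos_divide_le_eq[OF exp_gt_zero] mult.commute)
    moreover have "- real n * (\<theta> * x - \<Lambda> \<theta> + \<gamma>) \<le> real n * (\<Lambda> \<theta> - \<kappa>) - (real n * \<kappa> + c)"
    proof -
      have "- (\<theta> * x - \<Lambda> \<theta> + \<gamma>) \<le> (\<Lambda> \<theta> - \<kappa>) - (\<kappa> + (\<theta> * x + \<bar>\<theta>\<bar> * \<delta>))"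
        using \<kappa>(3) \<theta>\<delta> by linarith
      then have "real n * - (\<theta> * x - \<Lambda> \<theta> + \<gamma>) \<le> real n * ((\<Lambda> \<theta> - \<kappa>) - (\<kappa> + (\<theta> * x + \<bar>\<theta>\<bar> * \<delta>)))"
        using n by (intro mult_left_mono) auto
      then show ?thesis unfolding c_def by (simp add: algebra_simps)
    qed
    ultimately have "exp (- real n * (\<theta> * x - \<Lambda> \<theta> + \<gamma>)) \<le> prob ?E"
      by (meson exp_le_cancel_iff order_trans)
    also have "\<dots> \<le> prob {\<omega> \<in> space M. Z n \<omega> / real n \<in> W}"
    proof (rule finite_measure_mono)
      show "?E \<subseteq> {\<omega> \<in> space M. Z n \<omega> / real n \<in> W}" using \<delta>0 \<delta>(2) by (auto simp: subset_eq)
      have [measurable]: "W \<in> sets borel" using W by simp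
      show "{\<omega> \<in> space M. Z n \<omega> / real n \<in> W} \<in> events" by measurable
    qed
    finally show ?case .
  qed
qed

text \<open>The penalty \<open>\<epsilon> * \<theta>\<^sup>2 / 2\<close> forces the maximum of \<open>\<theta> * x - \<Lambda> \<theta>\<close>, which need not be
attained, to be attained at some \<open>\<theta>\<close>, where the derivative of \<open>\<Lambda>\<close> is \<open>y = x - \<epsilon> * \<theta>\<close>. Comparing the
maximum with the value 0 at the origin gives \<open>\<epsilon> * \<theta>\<^sup>2 \<le> 2 * r\<close>, so that
\<open>\<bar>y - x\<bar> = \<epsilon> * \<bar>\<theta>\<bar>\<close> is at most \<open>sqrt (2 * r * \<epsilon>)\<close>, which is small with \<open>\<epsilon>\<close>. Replacing
\<open>x\<close> by \<open>y\<close> changes \<open>\<theta> * x\<close> by \<open>- \<epsilon> * \<theta>\<^sup>2\<close>, so it does not increase the exponent.\<close>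

lemma exposed_approximation:
  assumes diff: "\<And>\<theta>. \<Lambda> differentiable at \<theta>" and fin: "rate x \<le> ereal r" and e: "e > 0"
  obtains \<theta> y where "(\<Lambda> has_real_derivative y) (at \<theta>)" "\<bar>y - x\<bar> < e" "\<theta> * y - \<Lambda> \<theta> \<le> r"
proof -
  have le: "\<theta> * x - \<Lambda> \<theta> \<le> r" for \<theta> using order_trans[OF rate_upper fin, of \<theta>] by simp
  have r: "r \<ge> 0" using le[of 0] by (simp add: \<Lambda>_0)
  define \<epsilon> where "\<epsilon> = e\<^sup>2 / (4 * r + 2)"
  have \<epsilon>: "\<epsilon> > 0" using e r by (simp add: \<epsilon>_def)
  have "(4 * r + 2) * \<epsilon> = e\<^sup>2" using r by (simp add: \<epsilon>_def)
  moreover have "r * \<epsilon> \<ge> 0" using r \<epsilon> by simp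
  ultimately have \<epsilon>r: "2 * r * \<epsilon> < e\<^sup>2" using e \<epsilon> by (simp add: algebra_simps)
  define \<phi> where "\<phi> = (\<lambda>\<theta>. \<theta> * x - \<Lambda> \<theta> - \<epsilon> * \<theta>\<^sup>2 / 2)"
  have cont: "continuous_on S \<Lambda>" for S
    using diff by (meson continuous_at_imp_continuous_on differentiable_imp_continuous_within)
  \<comment> \<open>Beyond \<open>R\<close> the penalty exceeds \<open>r\<close>, hence the penalised function is at most its value 0 at the origin.\<close>
  define R where "R = sqrt (2 * r / \<epsilon>) + 1"
  have R: "R > 0" using r \<epsilon> by (simp add: R_def add_nonneg_pos)
  have "\<exists>\<theta>\<in>{-R..R}. \<forall>\<theta>'\<in>{-R..R}. \<phi> \<theta>' \<le> \<phi> \<theta>"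
    using R unfolding \<phi>_def by (intro continuous_attains_sup continuous_intros cont) auto
  then obtain \<theta> where \<theta>: "\<And>\<theta>'. \<theta>' \<in> {-R..R} \<Longrightarrow> \<phi> \<theta>' \<le> \<phi> \<theta>" by blast
  have \<phi>0: "0 \<le> \<phi> \<theta>" using \<theta>[of 0] R by (simp add: \<phi>_def \<Lambda>_0)
  have max: "\<phi> \<theta>' \<le> \<phi> \<theta>" for \<theta>'
  proof (cases "\<theta>' \<in> {-R..R}")
    case False
    then have "sqrt (2 * r / \<epsilon>) \<le> \<bar>\<theta>'\<bar>" by (auto simp: R_def)
    then have "2 * r / \<epsilon> \<le> \<theta>'\<^sup>2" using real_le_rsqrt sqrt_le_D by fastforce
    then have "r \<le> \<epsilon> * \<theta>'\<^sup>2 / 2" using \<epsilon> by (simp add: field_simps)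
    then show ?thesis using le[of \<theta>'] \<phi>0 by (simp add: \<phi>_def)
  qed (use \<theta> in blast)
  obtain y where y: "(\<Lambda> has_real_derivative y) (at \<theta>)"
    using diff[of \<theta>] by (auto simp: real_differentiable_def)
  have "(\<phi> has_real_derivative (x - y - \<epsilon> * \<theta>)) (at \<theta>)"
    unfolding \<phi>_def by (auto intro!: derivative_eq_intros y simp: field_simps)
  then have "x - y - \<epsilon> * \<theta> = 0"
    by (rule DERIV_local_max[of _ _ _ 1]) (use max in auto)
  then have yx: "y = x - \<epsilon> * \<theta>" by simp
  have "\<epsilon> * \<theta>\<^sup>2 \<le> 2 * r" using \<phi>0 le[of \<theta>] by (simp add: \<phi>_def)
  then have "\<epsilon> * (\<epsilon> * \<theta>\<^sup>2) \<le> \<epsilon> * (2 * r)" using \<epsilon> by (intro mult_left_mono) auto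
  also have "\<dots> < e\<^sup>2" using \<epsilon>r by (simp add: mult_ac)
  finally have "(\<epsilon> * \<theta>)\<^sup>2 < e\<^sup>2" by (simp add: power2_eq_square mult_ac)
  then have "\<bar>\<epsilon> * \<theta>\<bar> < e" using e by (intro power2_less_imp_less[of "\<bar>\<epsilon> * \<theta>\<bar>" e]) simp_all
  moreover have "\<theta> * y - \<Lambda> \<theta> \<le> r"
  proof -
    have "\<theta> * y = \<theta> * x - \<epsilon> * \<theta>\<^sup>2" unfolding yx by (simp add: algebra_simps power2_eq_square)
    moreover have "\<epsilon> * \<theta>\<^sup>2 \<ge> 0" using \<epsilon> by simp
    ultimately show ?thesis using le[of \<theta>] by linarith
  qed
  ultimately show ?thesis using that[OF y] yx by (simp add: abs_minus_commute)
qed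

lemma rate_lower_semicontinuous: "lower_semicontinuous rate"
  unfolding lower_semicontinuous_def
proof
  fix x
  show "rate x \<le> Liminf (at x) rate"
    unfolding rate_def[of x]
  proof (rule SUP_least)
    fix \<theta> :: real
    have "((\<lambda>y. ereal (\<theta> * y - \<Lambda> \<theta>)) \<longlongrightarrow> ereal (\<theta> * x - \<Lambda> \<theta>)) (at x)"
      by (intro tendsto_intros)
    then have "ereal (\<theta> * x - \<Lambda> \<theta>) = Liminf (at x) (\<lambda>y. ereal (\<theta> * y - \<Lambda> \<theta>))"
      by (intro lim_imp_Liminf[symmetric]) auto
    also have "\<dots> \<le> Liminf (at x) rate"
      by (intro Liminf_mono always_eventually allI rate_upper)
    finally show "ereal (\<theta> * x - \<Lambda> \<theta>) \<le> Liminf (at x) rate" .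
  qed
qed

lemma rate_good: "good_rate_function rate"
  unfolding good_rate_function_def
proof (intro allI impI)
  fix c :: real
  have eq: "{x. rate x \<le> ereal c} = (\<Inter>\<theta>. {x. \<theta> * x - \<Lambda> \<theta> \<le> c})"
    by (auto simp: rate_def SUP_le_iff)
  have "closed {x. rate x \<le> ereal c}"
    unfolding eq by (intro closed_INT ballI closed_Collect_le continuous_intros)
  moreover have "{x. rate x \<le> ereal c} \<subseteq> {- (c + \<Lambda> (-1))..c + \<Lambda> 1}"
  proof
    fix x assume "x \<in> {x. rate x \<le> ereal c}"
    then have "\<theta> * x - \<Lambda> \<theta> \<le> c" for \<theta> unfolding eq by blast
    from this[of 1] this[of "-1"] show "x \<in> {- (c + \<Lambda> (-1))..c + \<Lambda> 1}" by auto
  qed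
  ultimately show "compact {x. rate x \<le> ereal c}"
    by (meson bounded_closed_interval bounded_subset compact_eq_bounded_closed)
qed

theorem large_deviation_principle:
  assumes diff: "\<And>\<theta>. \<Lambda> differentiable at \<theta>"
  shows "LDP M (\<lambda>n \<omega>. Z n \<omega> / real n) real rate"
  unfolding LDP_def
proof (intro conjI allI ballI impI rate_nonneg rate_lower_semicontinuous)
  show "prob_space M" by unfold_locales
  show "(\<lambda>\<omega>. Z n \<omega> / real n) \<in> borel_measurable M" for n by measurable
  show "0 < real n" if "1 \<le> n" for n using that by simp
  show "filterlim real at_top sequentially" by (rule filterlim_real_sequentially)
next
  fix A :: "real set" assume A: "A \<in> sets borel"
  define P where "P = (\<lambda>n. prob {\<omega> \<in> space M. Z n \<omega> / real n \<in> A})"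
  define L where "L = (\<lambda>n. ereal (1 / real n) * elog (P n))"
  have L_ge: "ereal b \<le> L n" if "n > 0" "exp (real n * b) \<le> P n" for n b
  proof -
    have P: "P n > 0" using that(2) less_le_trans[OF exp_gt_zero] by blast
    then have "real n * b \<le> ln (P n)" using that(2) by (simp add: ln_ge_iff)
    then show ?thesis using that(1) P by (simp add: L_def elog_def field_simps)
  qed
  have L_le: "L n \<le> ereal b" if "n > 0" "P n \<le> exp (real n * b)" for n b
  proof (cases "P n > 0")
    case True
    then have "ln (P n) \<le> real n * b" using that(2) by (metis ln_exp ln_mono)
    then show ?thesis using that(1) True by (simp add: L_def elog_def field_simps)
  next
    case False
    then show ?thesis using that(1) by (simp add: L_def elog_def)
  qed
  show "liminf (\<lambda>n. ereal (1 / real n) * elog (prob {\<omega> \<in> space M. Z n \<omega> / real n \<in> A}))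
    \<le> limsup (\<lambda>n. ereal (1 / real n) * elog (prob {\<omega> \<in> space M. Z n \<omega> / real n \<in> A}))"
    by (intro Liminf_le_Limsup) simp
  have lower: "- rate x \<le> liminf L" if x: "x \<in> interior A" for x
  proof (cases "rate x")
    case (real r)
    show ?thesis
      unfolding real uminus_ereal.simps
    proof (rule ereal_le_epsilon2)
      fix \<gamma> :: real assume \<gamma>: "\<gamma> > 0"
      obtain e where e: "e > 0" "ball x e \<subseteq> interior A"
        using x open_contains_ball[of "interior A"] by auto
      obtain \<theta> y where y: "(\<Lambda> has_real_derivative y) (at \<theta>)" "\<bar>y - x\<bar> < e" "\<theta> * y - \<Lambda> \<theta> \<le> r"
        by (rule exposed_approximation[OF diff, of x r e]) (use real e in auto)
      have yA: "y \<in> interior A" using y(2) e(2) by (auto simp: dist_real_def abs_minus_commute subset_eq)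
      have "\<forall>\<^sub>F n in sequentially. ereal (- r - \<gamma>) \<le> L n"
        using lower_bound_exposed[OF y(1) open_interior yA \<gamma>] eventually_gt_at_top[of 0]
      proof eventually_elim
        case (elim n)
        have "exp (real n * (- r - \<gamma>)) \<le> exp (- real n * (\<theta> * y - \<Lambda> \<theta> + \<gamma>))"
        proof -
          have "real n * (- r - \<gamma>) \<le> real n * - (\<theta> * y - \<Lambda> \<theta> + \<gamma>)"
            using y(3) by (intro mult_left_mono) auto
          then show ?thesis by (simp only: mult_minus_left mult_minus_right exp_le_cancel_iff)
        qed
        also note elim(1)
        also have "prob {\<omega> \<in> space M. Z n \<omega> / real n \<in> interior A} \<le> P n"
          unfolding P_def
        proof (rule finite_measure_mono)
          show "{\<omega> \<in> space M. Z n \<omega> / real n \<in> interior A} \<subseteq> {\<omega> \<in> space M. Z n \<omega> / real n \<in> A}"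
            using interior_subset by auto
          show "{\<omega> \<in> space M. Z n \<omega> / real n \<in> A} \<in> events" using A by measurable
        qed
        finally show ?case using elim(2) by (intro L_ge) auto
      qed
      then have "ereal (- r - \<gamma>) \<le> liminf L" by (rule Liminf_bounded)
      then show "ereal (- r) \<le> liminf L + ereal \<gamma>"
        by (cases "liminf L") auto
    qed
  next
    case PInf then show ?thesis by simp
  next
    case MInf then show ?thesis using rate_nonneg[of x] by simp
  qed
  have "- (INF x\<in>interior A. rate x) = (SUP x\<in>interior A. - rate x)"
    by (rule ereal_SUP_uminus_eq[symmetric])
  also have "\<dots> \<le> liminf L" using lower by (rule SUP_least)
  finally show "- (INF x\<in>interior A. rate x)
      \<le> liminf (\<lambda>n. ereal (1 / real n) * elog (prob {\<omega> \<in> space M. Z n \<omega> / real n \<in> A}))"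
    unfolding L_def P_def .
  have "limsup L \<le> - (INF x\<in>closure A. rate x)"
  proof (rule ccontr)
    assume "\<not> limsup L \<le> - (INF x\<in>closure A. rate x)"
    then have "- limsup L < (INF x\<in>closure A. rate x)"
      by (simp add: not_le ereal_uminus_less_reorder)
    then obtain \<beta> where \<beta>: "- limsup L < ereal \<beta>" "ereal \<beta> < (INF x\<in>closure A. rate x)"
      using ereal_dense2 by blast
    then obtain \<beta>' where \<beta>': "- limsup L < ereal \<beta>'" "\<beta>' < \<beta>"
      using ereal_dense2[OF \<beta>(1)] by auto
    have "ereal \<beta> < rate x" if "x \<in> closure A" for x
      using \<beta>(2) that by (meson INF_lower less_le_trans)
    then have "\<forall>\<^sub>F n in sequentially. P n \<le> exp (- real n * (\<beta> - (\<beta> - \<beta>')))"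
      unfolding P_def using \<beta>'(2) by (intro upper_bound) auto
    then have "\<forall>\<^sub>F n in sequentially. L n \<le> ereal (- \<beta>')"
      using eventually_gt_at_top[of 0] by eventually_elim (intro L_le; simp)
    then have "limsup L \<le> ereal (- \<beta>')" by (rule Limsup_bounded)
    then show False using \<beta>'(1) by (cases "limsup L") auto
  qed
  then show "limsup (\<lambda>n. ereal (1 / real n) * elog (prob {\<omega> \<in> space M. Z n \<omega> / real n \<in> A}))
      \<le> - (INF x\<in>closure A. rate x)"
    unfolding L_def P_def .
qed

end

section \<open>The moment generating function of a uniform variable\<close>

lemma expectation_of_uniform:
  fixes h :: "real \<Rightarrow> real"
  assumes U: "U \<in> borel_measurable M" and distr: "distr M lborel U = uniform_measure lborel {0..1}"
    and h: "continuous_on UNIV h"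
  shows "integral\<^sup>L M (\<lambda>\<omega>. h (U \<omega>)) = integral {0..1} h"
proof -
  have [measurable]: "h \<in> borel_measurable borel" using h by (rule borel_measurable_continuous_onI)
  have "integral\<^sup>L M (\<lambda>\<omega>. h (U \<omega>)) = integral\<^sup>L (distr M lborel U) h"
    using U by (subst integral_distr) auto
  also have "\<dots> = integral\<^sup>L (density lborel (\<lambda>x. ennreal (indicator {0..1} x))) h"
    unfolding distr uniform_measure_def by (simp add: divide_ennreal_def ennreal_indicator)
  also have "\<dots> = (LBINT x:{0..1}. h x)"
    unfolding set_lebesgue_integral_def by (subst integral_density) auto
  also have "\<dots> = integral {0..1} h"
    by (intro set_borel_integral_eq_integral borel_integrable_atLeastAtMost' continuous_on_subset[OF h]) auto
  finally show ?thesis .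
qed

lemma Lambda_tilde_eq:
  assumes f: "continuous_on UNIV f"
  shows "Lambda_tilde f \<theta> = ln (integral {0..1} (\<lambda>t. exp (\<theta> * f t)))"
proof -
  have "continuous_on {0..1} (\<lambda>t. exp (\<theta> * f t))"
    by (intro continuous_intros continuous_on_subset[OF f]) auto
  then show ?thesis
    unfolding Lambda_tilde_def
    by (subst set_borel_integral_eq_integral) (auto intro: borel_integrable_atLeastAtMost')
qed

lemma Lambda_tilde_differentiable:
  assumes f: "continuous_on UNIV f"
  shows "Lambda_tilde f differentiable at \<theta>"
proof -
  define m where "m = (\<lambda>\<theta>. integral (cbox 0 1) (\<lambda>t. exp (\<theta> * f t)))"
  have cont_snd: "continuous_on S (\<lambda>p::real \<times> real. f (snd p))" for S
    by (intro continuous_on_compose2[OF f] continuous_intros) auto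
  have int: "(\<lambda>t. exp (\<theta> * f t)) integrable_on cbox 0 1" for \<theta>
    by (intro integrable_continuous continuous_intros continuous_on_subset[OF f]) auto
  have D: "(m has_real_derivative integral (cbox 0 1) (\<lambda>t. f t * exp (\<theta> * f t))) (at \<theta>)"
    unfolding m_def
    by (rule leibniz_rule_field_derivative[where U = UNIV])
      (auto intro!: derivative_eq_intros int[simplified] continuous_intros cont_snd simp: split_beta)
  have pos: "m \<theta> > 0"
  proof -
    obtain B where B: "\<And>t. t \<in> {0..1} \<Longrightarrow> B \<le> exp (\<theta> * f t)" "B > 0"
    proof -
      have "\<exists>t\<in>{0..1}. \<forall>s\<in>{0..1}. exp (\<theta> * f t) \<le> exp (\<theta> * f s)"
        by (intro continuous_attains_inf continuous_intros continuous_on_subset[OF f]) auto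
      then show ?thesis using that exp_gt_zero by blast
    qed
    have "integral (cbox 0 1) (\<lambda>_::real. B) \<le> m \<theta>"
      unfolding m_def using B by (intro integral_le int integrable_const) auto
    then show ?thesis using B(2) by simp
  qed
  have "((\<lambda>\<theta>. ln (m \<theta>)) has_real_derivative
      inverse (m \<theta>) * integral (cbox 0 1) (\<lambda>t. f t * exp (\<theta> * f t))) (at \<theta>)"
    using pos D by (intro DERIV_chain2[OF DERIV_ln]) auto
  moreover have "(\<lambda>\<theta>. ln (m \<theta>)) = Lambda_tilde f"
    by (simp add: fun_eq_iff Lambda_tilde_eq[OF f] m_def)
  ultimately show ?thesis by (auto simp: real_differentiable_def)
qed

theorem theorem1:
  fixes f :: "real \<Rightarrow> real"
    and a :: "nat \<Rightarrow> nat"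
    and M :: "'a measure"
    and U :: "'a \<Rightarrow> real"
    and S :: "nat \<Rightarrow> 'a \<Rightarrow> real"
  assumes "continuous_on UNIV f"
    and "\<forall>x. f (x + 1) = f x"
    and "prob_space M"
    and "U \<in> borel_measurable M"
    and "distr M lborel U = uniform_measure lborel {0..1}"
    and "lacunary a"
    and "large_gaps a"
    and "\<And>n \<omega>. S n \<omega> = (\<Sum>k=1..n. f (real (a k) * U \<omega>))"
  shows "LDP M (\<lambda>n \<omega>. S n \<omega> / real n) real (I_tilde f) \<and> good_rate_function (I_tilde f)"
proof -
  note f = assms(1) and U [measurable] = assms(4) and S = assms(8)
  have per: "\<And>x. f (x + 1) = f x" using assms(2) by blast
  have a: "a k > 0" if "k \<ge> 1" for k using assms(6) that by (auto simp: lacunary_def)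
  have [measurable]: "f \<in> borel_measurable borel" using f by (rule borel_measurable_continuous_onI)
  obtain B where B: "\<And>x. \<bar>f x\<bar> \<le> B" using periodic_continuous_bounds[of f, OF f per] by blast
  interpret prob_space M by fact
  interpret bounded_log_mgf_limit M S B "Lambda_tilde f"
  proof
    show "S n \<in> borel_measurable M" for n
      unfolding S[abs_def] by measurable
    show "\<bar>S n \<omega>\<bar> \<le> real n * B" for n \<omega>
      unfolding S using sum_mono[of "{1..n}" "\<lambda>k. \<bar>f (real (a k) * U \<omega>)\<bar>" "\<lambda>_. B"] B
      by (intro order_trans[OF sum_abs]) auto
    fix \<theta>
    have cont: "continuous_on UNIV (\<lambda>t. exp (\<Sum>k=1..n. \<theta> * f (real (a k) * t)))" for n
      by (intro continuous_intros continuous_on_compose2[OF f]) auto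
    have mgf: "expectation (\<lambda>\<omega>. exp (\<theta> * S n \<omega>))
        = integral {0..1} (\<lambda>t. exp (\<Sum>k=1..n. \<theta> * f (real (a k) * t)))" for n
      using expectation_of_uniform[OF U assms(5) cont[of n]] by (simp add: S sum_distrib_left)
    show "(\<lambda>n. ln (expectation (\<lambda>\<omega>. exp (\<theta> * S n \<omega>))) / real n) \<longlonglongrightarrow> Lambda_tilde f \<theta>"
      unfolding mgf Lambda_tilde_eq[OF f]
      by (rule large_gaps_log_average[where h = "\<lambda>x. \<theta> * f x"])
        (auto intro!: continuous_intros f a assms(7) simp: per)
  qed
  have "rate = I_tilde f" by (simp add: fun_eq_iff rate_def I_tilde_def)
  then show ?thesis
    using large_deviation_principle[OF Lambda_tilde_differentiable[OF f]] rate_good by simp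
qed

end
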